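(* Let $n$ be a positive integer, let $\mathbf{A}$ be an incomplete pairwise comparison matrix of order $n$, and let $G$ be the undirected graph representing $\mathbf{A}$. Then the lexicographically optimal completion of $\mathbf{A}$ is unique (that is, there is exactly one lexicographically optimal completion of $\mathbf{A}$) if and only if $G$ is connected.
   Context: Let $\mathbb{R}_+$ denote the set of (strictly) positive real numbers. **Pairwise comparison matrix.** A matrix $\mathbf{A} = [a_{ij}] \in \mathbb{R}_+^{n \times n}$ is a pairwise comparison matrix if $a_{ji} = 1/a_{ij}$ for all $1 \leq i,j \leq n$ (so in particular $a_{ii} = 1$). **Incomplete pairwise comparison matrix.** A matrix $\mathbf{A} = [a_{ij}]$ of order $n$ is an incomplete pairwise comparison matrix if $a_{ij} \in \mathbb{R}_+ \cup \{\ast\}$ for all $1 \leq i,j \leq n$, where the symbol $\ast$ denotes a missing entry, and for all $1 \leq i,j \leq n$: $a_{ij} \in \mathbb{R}_+$ implies $a_{ji} = 1/a_{ij}$, and $a_{ij} = \ast$ implies $a_{ji} = \ast$. Diagonal entries are always known, $a_{ii} = 1$. (It is allowed that no entry is missing.) **Graph representation.** The undirected graph $G = (V,E)$ representing $\mathbf{A}$ has vertex set $V = \{1,2,\dots,n\}$, and for $i \neq j$, $(i,j) \in E$ if and only if $a_{ij} \neq \ast$. **Completion.** A completion of $\mathbf{A}$ is a (complete) pairwise comparison matrix $\mathbf{A}(\mathbf{x})$ of order $n$ obtained by replacing the missing entries of $\mathbf{A}$ by positive real values, collected in a vector $\mathbf{x}$, reciprocally (if $a_{ij} = \ast$ is replaced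 by $x_{ij}$, then $a_{ji}$ is replaced by $1/x_{ij}$); the known entries are left unchanged. **Triad inconsistency.** For a completion $\mathbf{A}(\mathbf{x})$ with entries $b_{ij}$ and three distinct indices $i < j < k$ in $\{1,\dots,n\}$, let $$t_{ijk}(\mathbf{x}) = \max\left\{ \frac{b_{ik}}{b_{ij} b_{jk}};\ \frac{b_{ij} b_{jk}}{b_{ik}} \right\}.$$ (This value does not depend on the order of the three indices.) **Lexicographically optimal completion.** Let $\theta(\mathbf{x})$ be the vector of the $n(n-1)(n-2)/6$ values $t_{ijk}(\mathbf{x})$, $1 \leq i<j<k \leq n$, arranged in non-increasing order, i.e. $\theta_u(\mathbf{x}) \geq \theta_v(\mathbf{x})$ for all $u < v$. A completion $\mathbf{A}(\mathbf{x})$ is a lexicographically optimal completion of $\mathbf{A}$ if, for any other completion $\mathbf{A}(\mathbf{y})$ of $\mathbf{A}$, there does not exist an index $1 \leq v \leq n(n-1)(n-2)/6$ such that $\theta_u(\mathbf{x}) = \theta_u(\mathbf{y})$ for all $u < v$ and $\theta_v(\mathbf{x}) > \theta_v(\mathbf{y})$. *)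

theory Defs
  imports "Jordan_Normal_Form.Matrix" "Graph_Theory.Graph_Theory"
begin

text \<open>
  Matrices are those of \<^theory>\<open>Jordan_Normal_Form.Matrix\<close>, so rows and columns of a matrix of
  order \<open>n\<close> are indexed by \<open>0, \<dots>, n - 1\<close>. In an incomplete matrix a known entry
  \<open>a\<close> is \<open>Some a\<close> and a missing entry is \<open>None\<close>.
\<close>

definition pairwise_comparison_matrix :: "nat \<Rightarrow> real mat \<Rightarrow> bool" where
  "pairwise_comparison_matrix n B \<longleftrightarrow>
     B \<in> carrier_mat n n \<and>
     (\<forall>i<n. \<forall>j<n. B $$ (i, j) > 0 \<and> B $$ (j, i) = 1 / B $$ (i, j))"

definition incomplete_pairwise_comparison_matrix :: "nat \<Rightarrow> real option mat \<Rightarrow> bool" where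
  "incomplete_pairwise_comparison_matrix n A \<longleftrightarrow>
     A \<in> carrier_mat n n \<and>
     (\<forall>i<n. \<forall>j<n.
        case A $$ (i, j) of
          Some a \<Rightarrow> a > 0 \<and> A $$ (j, i) = Some (1 / a)
        | None \<Rightarrow> A $$ (j, i) = None) \<and>
     (\<forall>i<n. A $$ (i, i) = Some 1)"

text \<open>
  An undirected edge is represented by the two opposite arcs; the arc set is symmetric whenever
  \<open>A\<close> is an incomplete pairwise comparison matrix (lemma \<open>pair_graph_comparison_graph\<close>).
\<close>

definition comparison_graph :: "nat \<Rightarrow> real option mat \<Rightarrow> nat pair_pre_digraph" where
  "comparison_graph n A =
     \<lparr> pverts = {0..<n},
       parcs = {(i, j). i < n \<and> j < n \<and> i \<noteq> j \<and> A $$ (i, j) \<noteq> None} \<rparr>"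

lemma pair_graph_comparison_graph:
  assumes "incomplete_pairwise_comparison_matrix n A"
  shows "pair_graph (comparison_graph n A)"
proof -
  have sym: "A $$ (j, i) \<noteq> None" if "i < n" "j < n" "A $$ (i, j) \<noteq> None" for i j
    using assms that by (fastforce simp: incomplete_pairwise_comparison_matrix_def)
  have "finite {(i, j). i < n \<and> j < n \<and> i \<noteq> j \<and> A $$ (i, j) \<noteq> None}"
    by (rule finite_subset[of _ "{0..<n} \<times> {0..<n}"]) auto
  then show ?thesis
    using sym by unfold_locales (auto simp: comparison_graph_def symmetric_def intro!: symI)
qed

definition completion :: "nat \<Rightarrow> real option mat \<Rightarrow> real mat \<Rightarrow> bool" where
  "completion n A B \<longleftrightarrow>
     pairwise_comparison_matrix n B \<and>
     (\<forall>i<n. \<forall>j<n. \<forall>a. A $$ (i, j) = Some a \<longrightarrow> B $$ (i, j) = a)"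

definition triads :: "nat \<Rightarrow> (nat \<times> nat \<times> nat) set" where
  "triads n = {(i, j, k). i < j \<and> j < k \<and> k < n}"

definition triad_inconsistency :: "real mat \<Rightarrow> nat \<times> nat \<times> nat \<Rightarrow> real" where
  "triad_inconsistency B = (\<lambda>(i, j, k).
     max (B $$ (i, k) / (B $$ (i, j) * B $$ (j, k)))
         (B $$ (i, j) * B $$ (j, k) / B $$ (i, k)))"

definition inconsistency_vector :: "nat \<Rightarrow> real mat \<Rightarrow> real list" where
  "inconsistency_vector n B =
     rev (sorted_list_of_multiset (image_mset (triad_inconsistency B) (mset_set (triads n))))"

lemma triads_Suc: "triads (Suc n) = triads n \<union> {(i, j, k). i < j \<and> j < n \<and> k = n}"
  by (auto simp: triads_def)

lemma finite_triads: "finite (triads n)"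
  by (rule finite_subset[of _ "{..<n} \<times> {..<n} \<times> {..<n}"]) (auto simp: triads_def)

lemma card_triads: "card (triads n) = n choose 3"
proof (induction n)
  case 0
  have "triads 0 = {}" by (auto simp: triads_def)
  then show ?case by simp
next
  case (Suc n)
  have pairs: "{(i, j, k). i < j \<and> j < n \<and> k = n} = (\<lambda>(j, i). (i, j, n)) ` (SIGMA j:{..<n}. {..<j})"
    by (auto simp: image_iff)
  have "card {(i, j, k). i < j \<and> j < n \<and> k = n} = card (SIGMA j:{..<n}. {..<j})"
    unfolding pairs by (rule card_image) (auto simp: inj_on_def)
  also have "\<dots> = \<Sum>{..<n}"
    by simp
  also have "\<dots> = n choose 2"
    by (induction n) (auto simp: numeral_2_eq_2)
  finally have "card {(i, j, k). i < j \<and> j < n \<and> k = n} = n choose 2" .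
  moreover have "finite {(i, j, k). i < j \<and> j < n \<and> k = n}"
    unfolding pairs by simp
  ultimately have "card (triads (Suc n)) = (n choose 3) + (n choose 2)"
    using Suc finite_triads unfolding triads_Suc
    by (subst card_Un_disjoint) (auto simp: triads_def)
  then show ?case
    by (simp add: numeral_3_eq_3 numeral_2_eq_2)
qed

lemma length_inconsistency_vector:
  "length (inconsistency_vector n B) = n * (n - 1) * (n - 2) div 6"
proof -
  have "length (inconsistency_vector n B) = size (mset (inconsistency_vector n B))"
    by (simp only: size_mset)
  also have "\<dots> = n choose 3"
    by (simp add: inconsistency_vector_def card_triads del: size_mset)
  also have "\<dots> = n * (n - 1) * (n - 2) div 6"
  proof -
    have "3 * (n choose 3) = n * ((n - 1) choose 2)"
      using binomial_absorption[of 2 n] by (simp add: numeral_3_eq_3 numeral_2_eq_2)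
    then have "6 * (n choose 3) = n * (2 * ((n - 1) choose 2))"
      by simp
    also have "2 * ((n - 1) choose 2) = (n - 1) * (n - 2)"
      using binomial_absorption[of 1 "n - 1"] by (simp add: numeral_2_eq_2)
    finally have "6 * (n choose 3) = n * (n - 1) * (n - 2)"
      by (simp only: mult.assoc)
    then show ?thesis by simp
  qed
  finally show ?thesis .
qed

definition lex_optimal_completion :: "nat \<Rightarrow> real option mat \<Rightarrow> real mat \<Rightarrow> bool" where
  "lex_optimal_completion n A B \<longleftrightarrow>
     completion n A B \<and>
     (\<forall>C. completion n A C \<and> C \<noteq> B \<longrightarrow>
        \<not> (\<exists>v < n * (n - 1) * (n - 2) div 6.
              (\<forall>u<v. inconsistency_vector n B ! u = inconsistency_vector n C ! u) \<and>
              inconsistency_vector n B ! v > inconsistency_vector n C ! v))"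

end

theory Submission
  imports Defs "HOL-Analysis.Function_Metric"
begin

text \<open>
  If the graph is disconnected, multiplying the entries from one component to its complement by a
  constant (and the opposite entries by its inverse) produces another completion with the same triads.

  If it is connected, a bound on all triads bounds every entry, by induction along paths, so
  a lexicographic minimum exists by compactness: the sum of the \<open>m\<close> largest values of finitely
  many continuous functions is the maximum of their sums over the \<open>m\<close>-element subsets, hence
  continuous. For uniqueness, let \<open>H\<close> be the entrywise geometric mean of two optimal completions
  \<open>B\<close> and \<open>C\<close>. By convexity of the sums of the \<open>m\<close> largest values, \<open>H\<close> is no worse than \<open>B\<close> and
  \<open>C\<close>, so all three have the same sorted vector and the same sum of squared triads. As
  \<open>t(H)\<^sup>2 \<le> t(B) t(C)\<close> for each triad, summing gives \<open>t(H) = t(B) = t(C)\<close>; then \<open>B / C\<close> is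
  consistent, and it equals 1 along the edges of a connected graph.
\<close>

section \<open>Lexicographic comparison\<close>

text \<open>Sequences are functions, so that a tail is an index shift and continuity can be stated
  entry by entry; only the indices below \<open>N\<close> count.\<close>

definition lex_below :: "nat \<Rightarrow> (nat \<Rightarrow> real) \<Rightarrow> (nat \<Rightarrow> real) \<Rightarrow> bool" where
  "lex_below N a b \<longleftrightarrow> (\<exists>v<N. (\<forall>u<v. a u = b u) \<and> a v < b v)"

lemma lex_below_Suc:
  "lex_below (Suc N) a b \<longleftrightarrow> a 0 < b 0 \<or> a 0 = b 0 \<and> lex_below N (\<lambda>v. a (Suc v)) (\<lambda>v. b (Suc v))"
  unfolding lex_below_def by (simp only: Ex_less_Suc2 All_less_Suc2) auto

lemma lex_below_imp_first_le:
  assumes "lex_below N a b"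
  shows "a 0 \<le> b 0"
  using assms by (cases N) (auto simp: lex_below_Suc lex_below_def[of 0])

lemma lex_below_linear:
  assumes "\<not> lex_below N a b" "\<not> lex_below N b a" "i < N"
  shows "a i = b i"
  using \<open>i < N\<close>
proof (induction i rule: less_induct)
  case (less i)
  then have "\<forall>u<i. a u = b u" by auto
  with assms(1,2) less.prems show ?case
    unfolding lex_below_def by (metis linorder_neqE)
qed

text \<open>At the first index \<open>v\<close> where the sequences differ, the partial sums of
  length \<open>Suc v\<close> differ exactly as the entries at \<open>v\<close> do. This passes from
  the lexicographic order to sums of the \<open>m\<close> largest values, which are convex.\<close>

lemma not_lex_below_if_partial_sums_le:
  assumes "\<And>m. m \<le> N \<Longrightarrow> sum a {..<m} \<le> sum b {..<m}"
  shows "\<not> lex_below N b a"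
proof
  assume "lex_below N b a"
  then obtain v where v: "v < N" "\<forall>u<v. b u = a u" "b v < a v"
    by (auto simp: lex_below_def)
  then have "sum a {..<v} = sum b {..<v}" by (intro sum.cong) auto
  with assms[of "Suc v"] v(1,3) show False by simp
qed

text \<open>The minimisers of the first coordinate form a closed, hence compact, subset; by
  induction the remaining coordinates have a lexicographic minimum on it.\<close>

lemma compact_lex_minimal:
  fixes K :: "'a::t2_space set" and \<theta> :: "'a \<Rightarrow> nat \<Rightarrow> real"
  assumes "compact K" "K \<noteq> {}" "\<And>v. v < N \<Longrightarrow> continuous_on K (\<lambda>x. \<theta> x v)"
  shows "\<exists>x\<in>K. \<forall>y\<in>K. \<not> lex_below N (\<theta> y) (\<theta> x)"
  using assms
proof (induction N arbitrary: K \<theta>)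
  case 0
  then show ?case by (auto simp: lex_below_def)
next
  case (Suc N)
  have cont: "continuous_on K (\<lambda>x. \<theta> x 0)" using Suc.prems by simp
  then obtain x0 where x0: "x0 \<in> K" "\<And>y. y \<in> K \<Longrightarrow> \<theta> x0 0 \<le> \<theta> y 0"
    using continuous_attains_inf[OF Suc.prems(1,2) cont] by blast
  define K' where "K' = {x \<in> K. \<theta> x 0 = \<theta> x0 0}"
  have "closed K'"
    unfolding K'_def
    using continuous_closed_preimage_constant[OF cont compact_imp_closed[OF Suc.prems(1)]] .
  then have "compact (K \<inter> K')" using Suc.prems(1) by blast
  moreover have "K \<inter> K' = K'" by (auto simp: K'_def)
  ultimately have "compact K'" by simp
  moreover have "K' \<noteq> {}" using x0 by (auto simp: K'_def)
  moreover have "continuous_on K' (\<lambda>x. \<theta> x (Suc v))" if "v < N" for v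
    by (rule continuous_on_subset[of K]) (use Suc.prems that in \<open>auto simp: K'_def\<close>)
  ultimately obtain x where x: "x \<in> K'"
    "\<And>y. y \<in> K' \<Longrightarrow> \<not> lex_below N (\<lambda>v. \<theta> y (Suc v)) (\<lambda>v. \<theta> x (Suc v))"
    using Suc.IH[of K' "\<lambda>x v. \<theta> x (Suc v)"] by blast
  have "\<not> lex_below (Suc N) (\<theta> y) (\<theta> x)" if "y \<in> K" for y
    using x x0(2)[OF that] that by (auto simp: lex_below_Suc K'_def)
  then show ?case using x(1) by (auto simp: K'_def)
qed

section \<open>Values of a function in non-increasing order\<close>

definition sorted_values :: "('a \<Rightarrow> real) \<Rightarrow> 'a set \<Rightarrow> real list" where
  "sorted_values f T = rev (sorted_list_of_multiset (image_mset f (mset_set T)))"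

lemma inconsistency_vector_eq_sorted_values:
  "inconsistency_vector n B = sorted_values (triad_inconsistency B) (triads n)"
  by (simp add: inconsistency_vector_def sorted_values_def)

lemma sorted_values_cong:
  assumes "finite T" "\<And>t. t \<in> T \<Longrightarrow> f t = g t"
  shows "sorted_values f T = sorted_values g T"
proof -
  have "image_mset f (mset_set T) = image_mset g (mset_set T)"
    using assms by (intro image_mset_cong) auto
  then show ?thesis by (simp add: sorted_values_def)
qed

text \<open>Sorting the elements of \<open>T\<close> and not just their values makes every prefix of
  the sorted vector come from a subset of \<open>T\<close>.\<close>

lemma decreasing_enumeration:
  assumes "finite T"
  obtains ts where "distinct ts" "set ts = T" "sorted_wrt (\<lambda>s t. f s \<ge> f t) ts"
    "sorted_values f T = map f ts"
proof -
  obtain xs where xs: "set xs = T" "distinct xs"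
    using finite_distinct_list[OF assms] by blast
  have "sort (map f xs) = map f (sort_key f xs)"
    by (rule properties_for_sort) auto
  moreover have "mset_set T = mset xs" using xs by (metis mset_set_set)
  ultimately have "sorted_values f T = map f (rev (sort_key f xs))"
    by (simp add: sorted_values_def rev_map flip: mset_map)
  moreover have "sorted_wrt (\<lambda>s t. f s \<ge> f t) (rev (sort_key f xs))"
    using sorted_sort_key[of f xs] by (simp add: sorted_wrt_rev sorted_wrt_map)
  ultimately show ?thesis using that[of "rev (sort_key f xs)"] xs by simp
qed

lemma sorted_values_first_ge:
  assumes "finite T" "t \<in> T"
  shows "f t \<le> sorted_values f T ! 0"
proof -
  obtain ts where ts: "distinct ts" "set ts = T" "sorted_wrt (\<lambda>s t. f s \<ge> f t) ts"
    "sorted_values f T = map f ts"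
    using decreasing_enumeration[OF assms(1)] .
  then show ?thesis using assms(2) by (cases ts) auto
qed

lemma sorted_values_first_in:
  assumes "finite T" "T \<noteq> {}"
  shows "sorted_values f T ! 0 \<in> f ` T"
proof -
  obtain ts where ts: "distinct ts" "set ts = T" "sorted_wrt (\<lambda>s t. f s \<ge> f t) ts"
    "sorted_values f T = map f ts"
    using decreasing_enumeration[OF assms(1)] .
  then show ?thesis using assms(2) by (cases ts) auto
qed

text \<open>Sorting only permutes the values. With squaring as \<open>h\<close>, equal sorted
  vectors give equal sums of squares.\<close>

lemma sum_sorted_values:
  assumes "finite T"
  shows "(\<Sum>i<card T. h (sorted_values f T ! i)) = (\<Sum>t\<in>T. h (f t))"
proof -
  obtain ts where ts: "distinct ts" "set ts = T" "sorted_wrt (\<lambda>s t. f s \<ge> f t) ts"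
    "sorted_values f T = map f ts"
    using decreasing_enumeration[OF assms(1)] .
  then have "card T = length ts" by (metis distinct_card)
  then have "(\<Sum>i<card T. h (sorted_values f T ! i)) = sum_list (map (\<lambda>t. h (f t)) ts)"
    using ts by (simp add: sum_list_sum_nth atLeast0LessThan)
  then show ?thesis using ts by (simp add: sum_list_distinct_conv_sum_set)
qed

text \<open>An exchange argument: the first \<open>m\<close> elements of a decreasing enumeration
  form a subset of maximal sum. A maximum of sums is both convex and continuous in \<open>f\<close>,
  which is not evident from the sorted vector.\<close>

lemma sum_first_sorted_values_eq_Max:
  assumes "finite T" "m \<le> card T"
  shows "(\<Sum>i<m. sorted_values f T ! i) = Max (sum f ` {S. S \<subseteq> T \<and> card S = m})"
proof -
  obtain ts where ts: "distinct ts" "set ts = T" "sorted_wrt (\<lambda>s t. f s \<ge> f t) ts"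
    "sorted_values f T = map f ts"
    using decreasing_enumeration[OF assms(1)] .
  have len: "length ts = card T" using ts(1,2) by (metis distinct_card)
  define U where "U = set (take m ts)"
  have U: "U \<subseteq> T" "card U = m"
    using ts(1,2) assms(2) len by (auto simp: U_def distinct_card dest: in_set_takeD)
  then have finU: "finite U" using assms(1) finite_subset by blast
  have "sum f U = sum_list (map f (take m ts))"
    using ts(1) by (simp add: U_def sum_list_distinct_conv_sum_set)
  also have "\<dots> = (\<Sum>i<m. sorted_values f T ! i)"
    using ts(4) assms(2) len by (simp add: sum_list_sum_nth atLeast0LessThan)
  finally have sum_U: "(\<Sum>i<m. sorted_values f T ! i) = sum f U" ..
  have "T = U \<union> set (drop m ts)"
    unfolding U_def ts(2)[symmetric] by (metis append_take_drop_id set_append)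
  moreover have "sorted_wrt (\<lambda>s t. f s \<ge> f t) (take m ts @ drop m ts)"
    using ts(3) by simp
  ultimately have ge: "f s \<le> f u" if "u \<in> U" "s \<in> T - U" for u s
    using that unfolding sorted_wrt_append U_def by blast
  have le: "sum f S \<le> sum f U" if S: "S \<subseteq> T" "card S = m" for S
  proof (cases "U - S = {}")
    case True
    then have "U = S" using S U finite_subset[OF S(1) assms(1)] by (metis Diff_eq_empty_iff card_subset_eq)
    then show ?thesis by simp
  next
    case False
    have finS: "finite S" using S assms(1) finite_subset by blast
    \<comment> \<open>This value separates the two differences: on \<open>S - U\<close> all values
      are at most \<open>c\<close>, on \<open>U - S\<close> at least \<open>c\<close>, and both sets
      have the same size.\<close>
    define c where "c = Min (f ` (U - S))"
    have "card (S - U) = card (U - S)"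
      using S U finS finU by (metis card_Diff_subset_Int card_Int_Diff finite_Int inf_commute)
    moreover have "sum f (S - U) \<le> of_nat (card (S - U)) * c"
      unfolding c_def
      by (rule sum_bounded_above) (use False finU S ge in auto)
    moreover have "of_nat (card (U - S)) * c \<le> sum f (U - S)"
      unfolding c_def by (rule sum_bounded_below) (use finU in auto)
    ultimately have "sum f (S - U) \<le> sum f (U - S)" by simp
    then show ?thesis
      using sum.Int_Diff[OF finS, of f U] sum.Int_Diff[OF finU, of f S] by (simp add: Int_commute)
  qed
  show ?thesis
    unfolding sum_U
    by (rule Max_eqI[symmetric]) (use assms(1) U le in auto)
qed

text \<open>Monotonicity and midpoint convexity of a maximum of linear functionals.\<close>

lemma sum_first_sorted_values_midpoint:
  assumes "finite T" "m \<le> card T" "\<And>t. t \<in> T \<Longrightarrow> h t \<le> (f t + g t) / 2"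
  shows "(\<Sum>i<m. sorted_values h T ! i) \<le>
    ((\<Sum>i<m. sorted_values f T ! i) + (\<Sum>i<m. sorted_values g T ! i)) / 2"
proof -
  let ?\<S> = "{S. S \<subseteq> T \<and> card S = m}"
  have fin: "finite ?\<S>" using assms(1) by simp
  have ne: "?\<S> \<noteq> {}" using obtain_subset_with_card_n[OF assms(2)] by (metis (mono_tags) empty_Collect_eq)
  have "sum h S \<le> (Max (sum f ` ?\<S>) + Max (sum g ` ?\<S>)) / 2" if "S \<in> ?\<S>" for S
  proof -
    have "sum h S \<le> (\<Sum>t\<in>S. (f t + g t) / 2)"
      by (rule sum_mono) (use that assms(3) in auto)
    also have "\<dots> = (sum f S + sum g S) / 2"
      by (simp add: sum.distrib flip: sum_divide_distrib)
    also have "\<dots> \<le> (Max (sum f ` ?\<S>) + Max (sum g ` ?\<S>)) / 2"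
      using fin that by (intro divide_right_mono add_mono Max_ge) auto
    finally show ?thesis .
  qed
  then show ?thesis
    unfolding sum_first_sorted_values_eq_Max[OF assms(1,2)]
    using fin ne by (intro Max.boundedI) blast+
qed

lemma continuous_on_Max:
  fixes f :: "'i \<Rightarrow> 'a::topological_space \<Rightarrow> real"
  assumes "finite I" "I \<noteq> {}" "\<And>i. i \<in> I \<Longrightarrow> continuous_on K (f i)"
  shows "continuous_on K (\<lambda>x. Max ((\<lambda>i. f i x) ` I))"
  using assms
proof (induction I rule: finite_ne_induct)
  case (insert i I)
  then have "continuous_on K (\<lambda>x. max (f i x) (Max ((\<lambda>i. f i x) ` I)))"
    by (intro continuous_on_max) auto
  then show ?case using insert by simp
qed simp

text \<open>A single sorted entry is the difference of two consecutive partial sums, each a maximum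
  of finitely many continuous functions.\<close>

lemma continuous_on_sorted_values:
  fixes f :: "'a::topological_space \<Rightarrow> 'i \<Rightarrow> real"
  assumes "finite T" "v < card T" "\<And>t. t \<in> T \<Longrightarrow> continuous_on K (\<lambda>x. f x t)"
  shows "continuous_on K (\<lambda>x. sorted_values (f x) T ! v)"
proof -
  have sums: "continuous_on K (\<lambda>x. \<Sum>i<m. sorted_values (f x) T ! i)" if "m \<le> card T" for m
    unfolding sum_first_sorted_values_eq_Max[OF assms(1) that]
  proof (rule continuous_on_Max)
    show "finite {S. S \<subseteq> T \<and> card S = m}" using assms(1) by simp
    show "{S. S \<subseteq> T \<and> card S = m} \<noteq> {}"
      using obtain_subset_with_card_n[OF that] by (metis (mono_tags) empty_Collect_eq)
    show "continuous_on K (\<lambda>x. sum (f x) S)" if "S \<in> {S. S \<subseteq> T \<and> card S = m}" for S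
      by (rule continuous_on_sum) (use that assms(3) in auto)
  qed
  have "continuous_on K (\<lambda>x. (\<Sum>i<Suc v. sorted_values (f x) T ! i) - (\<Sum>i<v. sorted_values (f x) T ! i))"
    by (intro continuous_on_diff sums) (use assms(2) in auto)
  then show ?thesis by simp
qed

text \<open>The inequality of arithmetic and geometric means puts \<open>h\<close> below the
  midpoint of \<open>f\<close> and \<open>g\<close>, so convexity bounds its partial sums by those
  of \<open>f\<close>. As \<open>h\<close> is not lexicographically below \<open>f\<close>, the
  sorted vectors coincide.\<close>

lemma lex_minimal_geometric_mean:
  fixes f g h :: "'a \<Rightarrow> real" and T :: "'a set"
  defines "\<theta> \<equiv> \<lambda>f v. sorted_values f T ! v"
  assumes "finite T"
    and nonneg: "\<And>t. t \<in> T \<Longrightarrow> f t \<ge> 0 \<and> g t \<ge> 0"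
    and mean: "\<And>t. t \<in> T \<Longrightarrow> h t ^ 2 \<le> f t * g t"
    and fg: "\<not> lex_below (card T) (\<theta> f) (\<theta> g)"
    and gf: "\<not> lex_below (card T) (\<theta> g) (\<theta> f)"
    and hf: "\<not> lex_below (card T) (\<theta> h) (\<theta> f)"
    and t: "t \<in> T"
  shows "f t = g t" "h t ^ 2 = f t ^ 2"
proof -
  have eq: "\<theta> f i = \<theta> g i" if "i < card T" for i
    using lex_below_linear[OF fg gf that] .
  have mid: "h t \<le> (f t + g t) / 2" if "t \<in> T" for t
  proof (rule power2_le_imp_le)
    have "h t ^ 2 \<le> f t * g t" using mean that by blast
    also have "\<dots> \<le> ((f t + g t) / 2) ^ 2"
      using zero_le_power2[of "f t - g t"] by (simp add: power2_eq_square field_simps)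
    finally show "h t ^ 2 \<le> ((f t + g t) / 2) ^ 2" .
    show "0 \<le> (f t + g t) / 2" using nonneg that by simp
  qed
  have "(\<Sum>i<m. \<theta> h i) \<le> (\<Sum>i<m. \<theta> f i)" if "m \<le> card T" for m
  proof -
    have "(\<Sum>i<m. \<theta> f i) = (\<Sum>i<m. \<theta> g i)"
      by (rule sum.cong) (use eq that in auto)
    with sum_first_sorted_values_midpoint[of T m h f g] assms(2) that mid show ?thesis
      by (simp add: \<theta>_def)
  qed
  then have "\<not> lex_below (card T) (\<theta> f) (\<theta> h)"
    by (rule not_lex_below_if_partial_sums_le)
  then have hfeq: "\<theta> h i = \<theta> f i" if "i < card T" for i
    using lex_below_linear[OF hf _ that] by blast
  have squares: "(\<Sum>t\<in>T. k t ^ 2) = (\<Sum>t\<in>T. f t ^ 2)"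
    if "\<And>i. i < card T \<Longrightarrow> \<theta> k i = \<theta> f i" for k
  proof -
    have "(\<Sum>i<card T. \<theta> k i ^ 2) = (\<Sum>i<card T. \<theta> f i ^ 2)"
      by (rule sum.cong) (use that in auto)
    then show ?thesis
      using sum_sorted_values[OF assms(2), of "\<lambda>x. x ^ 2"] by (simp add: \<theta>_def)
  qed
  have sg: "(\<Sum>t\<in>T. g t ^ 2) = (\<Sum>t\<in>T. f t ^ 2)" by (rule squares) (use eq in auto)
  have sh: "(\<Sum>t\<in>T. h t ^ 2) = (\<Sum>t\<in>T. f t ^ 2)" by (rule squares) (use hfeq in auto)
  \<comment> \<open>Equal sums of squares make this sum vanish; its summands are nonnegative, so
    each of them is zero.\<close>
  have "(\<Sum>t\<in>T. (f t - g t) ^ 2 + 2 * (f t * g t - h t ^ 2)) = (\<Sum>t\<in>T. f t ^ 2 + g t ^ 2 - 2 * h t ^ 2)"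
    by (rule sum.cong) (auto simp: power2_eq_square algebra_simps)
  also have "\<dots> = 0"
    using sg sh by (simp add: sum.distrib sum_subtractf flip: sum_distrib_left)
  finally have "(f t - g t) ^ 2 + 2 * (f t * g t - h t ^ 2) = 0"
    by (subst (asm) sum_nonneg_eq_0_iff) (use assms(2) mean t in auto)
  moreover have "f t * g t - h t ^ 2 \<ge> 0" using mean[OF t] by simp
  moreover have "(f t - g t) ^ 2 \<ge> 0" by simp
  ultimately have "(f t - g t) ^ 2 = 0 \<and> f t * g t - h t ^ 2 = 0"
    by (metis add_nonneg_eq_0_iff mult_eq_0_iff mult_nonneg_nonneg zero_le_numeral zero_neq_numeral)
  then show "f t = g t" "h t ^ 2 = f t ^ 2" by (auto simp: power2_eq_square)
qed

section \<open>Pairwise comparison matrices\<close>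

lemma pairwise_comparison_matrixD:
  assumes "pairwise_comparison_matrix n B" "i < n" "j < n"
  shows "B $$ (i, j) > 0" "B $$ (j, i) = 1 / B $$ (i, j)"
  using assms unfolding pairwise_comparison_matrix_def by blast+

lemma pairwise_comparison_matrix_diag:
  assumes "pairwise_comparison_matrix n B" "i < n"
  shows "B $$ (i, i) = 1"
proof -
  define b where "b = B $$ (i, i)"
  have "b > 0" "b = 1 / b"
    using pairwise_comparison_matrixD[OF assms(1,2,2)] by (simp_all only: b_def)
  then have "b * b = 1" by (metis less_irrefl nonzero_eq_divide_eq)
  with \<open>b > 0\<close> show ?thesis by (simp add: square_eq_1_iff b_def)
qed

text \<open>Unlike the maximum, this ratio is multiplicative in the entries, so it is compatible
  with entrywise products, quotients and square roots of matrices.\<close>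

definition triad_ratio :: "real mat \<Rightarrow> nat \<times> nat \<times> nat \<Rightarrow> real" where
  "triad_ratio B = (\<lambda>(i, j, k). B $$ (i, k) / (B $$ (i, j) * B $$ (j, k)))"

lemma triad_inconsistency_eq_max_ratio:
  "triad_inconsistency B t = max (triad_ratio B t) (1 / triad_ratio B t)"
  by (auto simp: triad_inconsistency_def triad_ratio_def split: prod.splits)

lemma triad_ratio_pos:
  assumes "pairwise_comparison_matrix n B" "t \<in> triads n"
  shows "triad_ratio B t > 0"
  using assms(2) pairwise_comparison_matrixD(1)[OF assms(1)]
  by (auto simp: triads_def triad_ratio_def)

lemma triad_inconsistency_pos:
  assumes "pairwise_comparison_matrix n B" "t \<in> triads n"
  shows "triad_inconsistency B t > 0"
  using triad_ratio_pos[OF assms] by (simp add: triad_inconsistency_eq_max_ratio)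

text \<open>Permuting the indices of a triad keeps its ratio or inverts it, and the maximum bounds
  both; when indices coincide, \<open>M \<ge> 1\<close> suffices. The result is a multiplicative
  triangle inequality up to the factor \<open>M\<close>, to be iterated along paths.\<close>

lemma triad_bound_all_orders:
  assumes B: "pairwise_comparison_matrix n B" and "M \<ge> 1"
    and M: "\<And>t. t \<in> triads n \<Longrightarrow> triad_inconsistency B t \<le> M"
    and "i < n" "j < n" "k < n"
  shows "B $$ (i, k) \<le> M * (B $$ (i, j) * B $$ (j, k))"
proof -
  note pos = pairwise_comparison_matrixD(1)[OF B]
  note inv = pairwise_comparison_matrixD(2)[OF B]
  have orders: "B $$ (a, c) \<le> M * (B $$ (a, b) * B $$ (b, c)) \<and>
    B $$ (c, a) \<le> M * (B $$ (c, b) * B $$ (b, a)) \<and>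
    B $$ (a, b) \<le> M * (B $$ (a, c) * B $$ (c, b)) \<and>
    B $$ (b, a) \<le> M * (B $$ (b, c) * B $$ (c, a)) \<and>
    B $$ (b, c) \<le> M * (B $$ (b, a) * B $$ (a, c)) \<and>
    B $$ (c, b) \<le> M * (B $$ (c, a) * B $$ (a, b))"
    if "a < b" "b < c" "c < n" for a b c
  proof -
    have lt: "a < n" "b < n" using that by auto
    define x y z where xyz: "x = B $$ (a, b)" "y = B $$ (b, c)" "z = B $$ (a, c)"
    have p: "x > 0" "y > 0" "z > 0" using pos lt that by (auto simp: xyz)
    have i: "B $$ (b, a) = 1 / x" "B $$ (c, b) = 1 / y" "B $$ (c, a) = 1 / z"
      unfolding xyz using inv lt that(3) by blast+
    have "(a, b, c) \<in> triads n" using that by (auto simp: triads_def)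
    from M[OF this] have "z / (x * y) \<le> M" "x * y / z \<le> M"
      by (auto simp: triad_inconsistency_def xyz)
    then have "z \<le> M * (x * y)" "x * y \<le> M * z" using p by (auto simp: field_simps)
    then show ?thesis
      unfolding i xyz[symmetric] using p by (simp add: field_simps)
  qed
  consider "i = j" | "j = k" | "i = k" | "i < j" "j < k" | "k < j" "j < i" | "i < k" "k < j"
    | "j < k" "k < i" | "j < i" "i < k" | "k < i" "i < j"
    by linarith
  then show ?thesis
  proof cases
    case 1
    then show ?thesis
      using pos[of i k] assms by (simp add: pairwise_comparison_matrix_diag[OF B])
  next
    case 2
    then show ?thesis
      using pos[of i k] assms by (simp add: pairwise_comparison_matrix_diag[OF B])
  next
    case 3
    then show ?thesis
      using pos[of i j] inv[of i j] assms by (simp add: pairwise_comparison_matrix_diag[OF B])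
  qed (use orders assms in blast)+
qed

lemma completionD:
  assumes "completion n A B"
  shows "pairwise_comparison_matrix n B"
    and "\<lbrakk>i < n; j < n; A $$ (i, j) = Some a\<rbrakk> \<Longrightarrow> B $$ (i, j) = a"
  using assms unfolding completion_def by blast+

lemma mat_eq_if_pairwise_comparison_matrix:
  assumes "pairwise_comparison_matrix n B" "pairwise_comparison_matrix n C"
    and "\<And>i j. \<lbrakk>i < n; j < n\<rbrakk> \<Longrightarrow> B $$ (i, j) = C $$ (i, j)"
  shows "B = C"
proof -
  have "B \<in> carrier_mat n n" "C \<in> carrier_mat n n"
    using assms(1,2) unfolding pairwise_comparison_matrix_def by blast+
  with assms(3) show ?thesis by (intro eq_matI) auto
qed

text \<open>Brings optimality into the form of minimality for \<open>lex_below\<close>, to which the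
  results on sorted values apply; irreflexivity covers the case \<open>C = B\<close>.\<close>

lemma lex_optimal_completion_iff:
  "lex_optimal_completion n A B \<longleftrightarrow> completion n A B \<and>
     (\<forall>C. completion n A C \<longrightarrow> \<not> lex_below (card (triads n))
       (\<lambda>v. sorted_values (triad_inconsistency C) (triads n) ! v)
       (\<lambda>v. sorted_values (triad_inconsistency B) (triads n) ! v))"
proof -
  have "n * (n - 1) * (n - 2) div 6 = card (triads n)"
    using length_inconsistency_vector[of n B]
    by (simp add: inconsistency_vector_def flip: size_mset)
  moreover have "\<not> lex_below N a a" for N a by (auto simp: lex_below_def)
  ultimately show ?thesis
    unfolding lex_optimal_completion_def inconsistency_vector_eq_sorted_values lex_below_def
    by (metis (no_types, lifting))
qed

section \<open>Reachability in the graph of an incomplete matrix\<close>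

text \<open>Connectedness is defined as strong connectedness of the symmetric closure. The arcs are
  symmetric already, so reachability is the same in both; \<open>n > 0\<close> provides the required
  vertex.\<close>

lemma connected_comparison_graph_iff:
  assumes "incomplete_pairwise_comparison_matrix n A" "n > 0"
  shows "Digraph_Component.connected (with_proj (comparison_graph n A)) \<longleftrightarrow>
    (\<forall>i<n. \<forall>j<n. i \<rightarrow>\<^sup>*\<^bsub>with_proj (comparison_graph n A)\<^esub> j)"
proof -
  interpret pair_graph "comparison_graph n A"
    using pair_graph_comparison_graph[OF assms(1)] .
  have verts: "pverts (comparison_graph n A) = {0..<n}" by (simp add: comparison_graph_def)
  show ?thesis
    unfolding Digraph_Component.connected_def strongly_connected_def
    using assms(2) by (auto simp: reachable_mk_symmetric_eq[OF sym_arcs] verts)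
qed

lemma reachable_comparison_graph_induct [consumes 3, case_names refl step]:
  assumes "incomplete_pairwise_comparison_matrix n A"
    and "i \<rightarrow>\<^sup>*\<^bsub>with_proj (comparison_graph n A)\<^esub> j" "i < n"
    and "P i"
    and "\<And>j k a. \<lbrakk>j < n; k < n; A $$ (j, k) = Some a; P j\<rbrakk> \<Longrightarrow> P k"
  shows "P j"
proof -
  interpret pair_graph "comparison_graph n A"
    using pair_graph_comparison_graph[OF assms(1)] .
  show ?thesis
    using assms(2)
    by (induction rule: reachable_induct) (use assms(4,5) in \<open>auto simp: comparison_graph_def\<close>)
qed

lemma reachable_comparison_graph_step:
  assumes "incomplete_pairwise_comparison_matrix n A"
    and "i \<rightarrow>\<^sup>*\<^bsub>with_proj (comparison_graph n A)\<^esub> j" "j < n" "k < n"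
    and "A $$ (j, k) = Some a"
  shows "i \<rightarrow>\<^sup>*\<^bsub>with_proj (comparison_graph n A)\<^esub> k"
\<comment> \<open>Diagonal entries are known, but the graph has no loops.\<close>
proof (cases "j = k")
  case False
  interpret pair_graph "comparison_graph n A"
    using pair_graph_comparison_graph[OF assms(1)] .
  have "(j, k) \<in> parcs (comparison_graph n A)"
    using assms(3-5) False by (auto simp: comparison_graph_def)
  then show ?thesis by (rule reachable_adj_trans[OF assms(2)])
qed (use assms(2) in simp)

section \<open>Disconnected graphs\<close>

lemma not_unique_if_disconnected:
  assumes A: "incomplete_pairwise_comparison_matrix n A"
    and B: "lex_optimal_completion n A B"
    and ij: "i < n" "j < n" "\<not> i \<rightarrow>\<^sup>*\<^bsub>with_proj (comparison_graph n A)\<^esub> j"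
  shows "\<exists>C. lex_optimal_completion n A C \<and> C \<noteq> B"
proof -
  let ?S = "{k. i \<rightarrow>\<^sup>*\<^bsub>with_proj (comparison_graph n A)\<^esub> k}"
  \<comment> \<open>Conjugating \<open>B\<close> by the diagonal matrix of \<open>d\<close> cancels
    in every triad ratio. The entry at \<open>(i, j)\<close> is doubled, as \<open>i\<close> reaches
    itself but not \<open>j\<close>; any positive constant other than 1 would do in place of
    2.\<close>
  define d :: "nat \<Rightarrow> real" where "d k = (if k \<in> ?S then 2 else 1)" for k
  have d: "d k > 0" for k by (simp add: d_def)
  define C where "C = mat n n (\<lambda>(p, q). B $$ (p, q) * d p / d q)"
  have C: "C $$ (p, q) = B $$ (p, q) * d p / d q" if "p < n" "q < n" for p q
    using that by (simp add: C_def)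
  have compB: "completion n A B" using B by (simp add: lex_optimal_completion_def)
  note pos = pairwise_comparison_matrixD[OF completionD(1)[OF compB]]
  have "pairwise_comparison_matrix n C"
    unfolding pairwise_comparison_matrix_def
  proof (intro conjI allI impI)
    show "C \<in> carrier_mat n n" by (simp add: C_def)
    fix p q assume pq: "p < n" "q < n"
    show "C $$ (p, q) > 0" using pq pos(1) d by (simp add: C)
    show "C $$ (q, p) = 1 / C $$ (p, q)" using pq by (simp add: C pos(2)[OF pq])
  qed
  moreover have "C $$ (p, q) = a" if "p < n" "q < n" "A $$ (p, q) = Some a" for p q a
  proof -
    \<comment> \<open>The reversed entry is known too, so \<open>p\<close> lies in the component of
      \<open>i\<close> exactly when \<open>q\<close> does.\<close>
    have "A $$ (q, p) = Some (1 / a)"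
      using A that by (fastforce simp: incomplete_pairwise_comparison_matrix_def)
    then have "d p = d q"
      using reachable_comparison_graph_step[OF A] that unfolding d_def by auto
    then show ?thesis
      using completionD(2)[OF compB that] C[OF that(1,2)] d[of q] by simp
  qed
  ultimately have compC: "completion n A C" by (simp add: completion_def)
  have "sorted_values (triad_inconsistency C) (triads n) = sorted_values (triad_inconsistency B) (triads n)"
  proof (rule sorted_values_cong[OF finite_triads])
    fix t assume "t \<in> triads n"
    then obtain p q r where t: "t = (p, q, r)" "p < n" "q < n" "r < n"
      by (auto simp: triads_def)
    have "d p \<noteq> 0" "d q \<noteq> 0" "d r \<noteq> 0" using d by (simp_all add: less_imp_neq[symmetric])
    then have "triad_ratio C t = triad_ratio B t"
      using t by (simp add: triad_ratio_def C)
    then show "triad_inconsistency C t = triad_inconsistency B t"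
      by (simp add: triad_inconsistency_eq_max_ratio)
  qed
  with B compC have "lex_optimal_completion n A C" by (simp add: lex_optimal_completion_iff)
  moreover have "C $$ (i, j) \<noteq> B $$ (i, j)"
  proof -
    interpret pair_graph "comparison_graph n A"
      using pair_graph_comparison_graph[OF A] .
    have "i \<in> verts (with_proj (comparison_graph n A))" using ij(1) by (simp add: comparison_graph_def)
    then have "i \<in> ?S" by simp
    with ij pos(1)[OF ij(1,2)] show ?thesis by (simp add: C d_def)
  qed
  ultimately show ?thesis by auto
qed

section \<open>Uniqueness for connected graphs\<close>

lemma lex_optimal_completion_unique:
  assumes A: "incomplete_pairwise_comparison_matrix n A"
    and conn: "\<And>i j. \<lbrakk>i < n; j < n\<rbrakk> \<Longrightarrow> i \<rightarrow>\<^sup>*\<^bsub>with_proj (comparison_graph n A)\<^esub> j"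
    and B: "lex_optimal_completion n A B" and C: "lex_optimal_completion n A C"
  shows "B = C"
proof -
  have compB: "completion n A B" and compC: "completion n A C"
    using B C by (auto simp: lex_optimal_completion_def)
  note pcB = completionD(1)[OF compB] and pcC = completionD(1)[OF compC]
  note posB = pairwise_comparison_matrixD[OF pcB] and posC = pairwise_comparison_matrixD[OF pcC]
  \<comment> \<open>In logarithmic coordinates this is the midpoint of \<open>B\<close> and
    \<open>C\<close>, so it is again a completion.\<close>
  define H where "H = mat n n (\<lambda>(p, q). sqrt (B $$ (p, q) * C $$ (p, q)))"
  have H: "H $$ (p, q) = sqrt (B $$ (p, q) * C $$ (p, q))" if "p < n" "q < n" for p q
    using that by (simp add: H_def)
  have "pairwise_comparison_matrix n H"
    unfolding pairwise_comparison_matrix_def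
  proof (intro conjI allI impI)
    show "H \<in> carrier_mat n n" by (simp add: H_def)
    fix p q assume pq: "p < n" "q < n"
    show "H $$ (p, q) > 0" using pq posB(1) posC(1) by (simp add: H)
    show "H $$ (q, p) = 1 / H $$ (p, q)"
      using pq by (simp add: H posB(2)[OF pq] posC(2)[OF pq] real_sqrt_mult real_sqrt_divide)
  qed
  moreover have "H $$ (p, q) = a" if "p < n" "q < n" "A $$ (p, q) = Some a" for p q a
    using completionD(2)[OF compB that] completionD(2)[OF compC that] posB(1)[OF that(1,2)]
      H[OF that(1,2)] by simp
  ultimately have compH: "completion n A H" by (simp add: completion_def)
  have ratioH: "triad_ratio H t ^ 2 = triad_ratio B t * triad_ratio C t" if "t \<in> triads n" for t
  proof -
    from that obtain p q r where t: "t = (p, q, r)" "p < n" "q < n" "r < n"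
      by (auto simp: triads_def)
    have "sqrt (B $$ (x, y) * C $$ (x, y)) ^ 2 = B $$ (x, y) * C $$ (x, y)" if "x < n" "y < n" for x y
      using posB(1)[OF that] posC(1)[OF that] by simp
    then show ?thesis
      using t by (simp add: triad_ratio_def H power_divide power_mult_distrib del: real_sqrt_pow2_iff)
  qed
  \<comment> \<open>Only the square of a ratio of \<open>H\<close> is a product of ratios of
    \<open>B\<close> and \<open>C\<close>; the square is therefore moved inside the maximum.\<close>
  have sq_max: "max r (1 / r) ^ 2 = max (r ^ 2) (1 / r ^ 2)" if "r > 0" for r :: real
  proof (cases "r \<le> 1 / r")
    case True
    moreover from this have "r ^ 2 \<le> (1 / r) ^ 2" using that by (intro power_mono) auto
    ultimately show ?thesis by (simp add: max_absorb2 power_one_over)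
  next
    case False
    moreover from this have "(1 / r) ^ 2 \<le> r ^ 2" using that by (intro power_mono) auto
    ultimately show ?thesis by (simp add: max_absorb1 power_one_over)
  qed
  have mean: "triad_inconsistency H t ^ 2 \<le> triad_inconsistency B t * triad_inconsistency C t"
    if t: "t \<in> triads n" for t
  proof -
    note rB = triad_ratio_pos[OF pcB t] and rC = triad_ratio_pos[OF pcC t]
    have "triad_inconsistency H t ^ 2 =
        max (triad_ratio B t * triad_ratio C t) (1 / triad_ratio B t * (1 / triad_ratio C t))"
      unfolding triad_inconsistency_eq_max_ratio
      using sq_max[OF triad_ratio_pos[OF completionD(1)[OF compH] t]] ratioH[OF t] by simp
    also have "\<dots> \<le> triad_inconsistency B t * triad_inconsistency C t"
      unfolding triad_inconsistency_eq_max_ratio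
      using rB rC by (intro max.boundedI mult_mono) auto
    finally show ?thesis .
  qed
  have nonneg: "triad_inconsistency B t \<ge> 0 \<and> triad_inconsistency C t \<ge> 0" if "t \<in> triads n" for t
    using triad_inconsistency_pos[OF pcB that] triad_inconsistency_pos[OF pcC that] by simp
  note geometric_mean = lex_minimal_geometric_mean[where f = "triad_inconsistency B" and
      g = "triad_inconsistency C" and h = "triad_inconsistency H", OF finite_triads nonneg mean]
  have "triad_inconsistency B t = triad_inconsistency C t"
    "triad_inconsistency H t ^ 2 = triad_inconsistency B t ^ 2" if t: "t \<in> triads n" for t
    using geometric_mean[OF _ _ _ _ _ t] B C compB compC compH
    unfolding lex_optimal_completion_iff by blast+
  \<comment> \<open>Equality of \<open>max r (1 / r)\<close> and \<open>max s (1 / s)\<close> still allows \<open>s = 1 / r\<close>; the triad of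
    the geometric mean, which would then be 1, excludes this unless \<open>r = s = 1\<close>.\<close>
  moreover have "r = s" if "r > 0" "s > 0" "max r (1 / r) = max s (1 / s)"
    "max (r * s) (1 / (r * s)) = max r (1 / r) ^ 2" for r s :: real
  proof (rule ccontr)
    assume "r \<noteq> s"
    with that have "s = 1 / r" by (auto simp: max_def field_simps split: if_splits)
    have "r * s = 1" using \<open>s = 1 / r\<close> \<open>r > 0\<close> by simp
    then have "max r (1 / r) ^ 2 = 1" using that(4) by simp
    then have "max r (1 / r) = 1" using \<open>r > 0\<close> by (auto simp: power2_eq_1_iff max_def split: if_splits)
    then have "r \<le> 1" "1 / r \<le> 1" by (metis max.cobounded1 max.cobounded2)+
    then have "r = 1" using \<open>r > 0\<close> by (simp add: field_simps)
    with \<open>s = 1 / r\<close> \<open>r \<noteq> s\<close> show False by simp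
  qed
  ultimately have ratio: "triad_ratio B t = triad_ratio C t" if "t \<in> triads n" for t
    using triad_ratio_pos[OF pcB that] triad_ratio_pos[OF pcC that]
      sq_max[OF triad_ratio_pos[OF completionD(1)[OF compH] that]] ratioH[OF that] that
    by (simp add: triad_inconsistency_eq_max_ratio)
  define D where "D = mat n n (\<lambda>(p, q). B $$ (p, q) / C $$ (p, q))"
  have D: "D $$ (p, q) = B $$ (p, q) / C $$ (p, q)" if "p < n" "q < n" for p q
    using that by (simp add: D_def)
  have pcD: "pairwise_comparison_matrix n D"
    unfolding pairwise_comparison_matrix_def
  proof (intro conjI allI impI)
    show "D \<in> carrier_mat n n" by (simp add: D_def)
    fix p q assume pq: "p < n" "q < n"
    show "D $$ (p, q) > 0" using pq posB(1) posC(1) by (simp add: D)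
    show "D $$ (q, p) = 1 / D $$ (p, q)"
      using pq by (simp add: D posB(2)[OF pq] posC(2)[OF pq])
  qed
  have "triad_inconsistency D t \<le> 1" if "t \<in> triads n" for t
  proof -
    from that obtain p q r where t: "t = (p, q, r)" "p < n" "q < n" "r < n"
      by (auto simp: triads_def)
    then have "triad_ratio D t = triad_ratio B t / triad_ratio C t"
      by (simp add: triad_ratio_def D mult_ac)
    then have "triad_ratio D t = 1" using ratio[OF that] triad_ratio_pos[OF pcC that] by simp
    then show ?thesis by (simp add: triad_inconsistency_eq_max_ratio)
  qed
  then have subadd: "D $$ (p, r) \<le> 1 * (D $$ (p, q) * D $$ (q, r))"
    if "p < n" "q < n" "r < n" for p q r
    by (intro triad_bound_all_orders[OF pcD]) (use that in auto)
  \<comment> \<open>All triads of \<open>D\<close> are at most 1, so the triangle inequality holds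
    with factor 1, and \<open>D\<close> is 1 at known entries. Hence the bound 1 propagates along
    paths; exchanging \<open>p\<close> and \<open>q\<close> later yields equality.\<close>
  have le: "D $$ (p, q) \<le> 1" if "p < n" "q < n" for p q
  proof -
    have "q < n \<and> D $$ (p, q) \<le> 1"
      using A conn[OF that] \<open>p < n\<close>
    proof (induction rule: reachable_comparison_graph_induct)
      case refl
      then show ?case using \<open>p < n\<close> by (simp add: pairwise_comparison_matrix_diag[OF pcD])
    next
      case (step q r a)
      have "D $$ (q, r) = 1"
        using step completionD(2)[OF compB, of q r] completionD(2)[OF compC, of q r]
          posC(1)[of q r] by (simp add: D)
      with subadd[of p q r] step \<open>p < n\<close> show ?case by simp
    qed
    then show ?thesis ..
  qed
  show ?thesis
  proof (rule mat_eq_if_pairwise_comparison_matrix[OF pcB pcC])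
    fix p q assume pq: "p < n" "q < n"
    have "D $$ (p, q) \<le> 1" "1 / D $$ (p, q) \<le> 1"
      using le pq pairwise_comparison_matrixD(2)[OF pcD pq] by metis+
    then have "D $$ (p, q) = 1"
      using pairwise_comparison_matrixD(1)[OF pcD pq] by (simp add: field_simps)
    then show "B $$ (p, q) = C $$ (p, q)" using posC(1)[OF pq] pq by (simp add: D field_simps)
  qed
qed

section \<open>Existence for connected graphs\<close>

lemma completion_exists:
  assumes "incomplete_pairwise_comparison_matrix n A"
  shows "\<exists>B. completion n A B"
proof -
  \<comment> \<open>The filler 1 is its own reciprocal.\<close>
  define B :: "real mat" where "B = mat n n (\<lambda>p. case A $$ p of Some a \<Rightarrow> a | None \<Rightarrow> 1)"
  have "B $$ (i, j) > 0 \<and> B $$ (j, i) = 1 / B $$ (i, j)" if "i < n" "j < n" for i j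
  proof -
    have "case A $$ (i, j) of Some a \<Rightarrow> a > 0 \<and> A $$ (j, i) = Some (1 / a) | None \<Rightarrow> A $$ (j, i) = None"
      using assms that unfolding incomplete_pairwise_comparison_matrix_def by blast
    then show ?thesis using that by (auto simp: B_def split: option.splits)
  qed
  moreover have "B \<in> carrier_mat n n" by (simp add: B_def)
  ultimately have "pairwise_comparison_matrix n B"
    unfolding pairwise_comparison_matrix_def by blast
  then have "completion n A B"
    unfolding completion_def by (auto simp: B_def)
  then show ?thesis ..
qed

text \<open>Each step of a path multiplies the upper bound by \<open>M\<close> and the known entry,
  neither of which depends on the completion; reciprocity turns upper bounds into lower ones. The
  set \<open>\<B>\<close> lets the bound be chosen before the matrix.\<close>

lemma completion_entries_bounded:
  assumes A: "incomplete_pairwise_comparison_matrix n A" and "M \<ge> 1"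
    and conn: "\<And>i j. \<lbrakk>i < n; j < n\<rbrakk> \<Longrightarrow> i \<rightarrow>\<^sup>*\<^bsub>with_proj (comparison_graph n A)\<^esub> j"
  obtains L where "L \<ge> 1"
    "\<And>B i j. \<lbrakk>completion n A B; \<And>t. t \<in> triads n \<Longrightarrow> triad_inconsistency B t \<le> M; i < n; j < n\<rbrakk>
      \<Longrightarrow> B $$ (i, j) \<in> {1 / L..L}"
proof -
  define \<B> where "\<B> = {B. completion n A B \<and> (\<forall>t\<in>triads n. triad_inconsistency B t \<le> M)}"
  have pc: "pairwise_comparison_matrix n B" if "B \<in> \<B>" for B
    using that completionD(1) by (auto simp: \<B>_def)
  have "\<exists>c. \<forall>B\<in>\<B>. B $$ (i, j) \<le> c" if "i < n" "j < n" for i j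
    using A conn[OF that] \<open>i < n\<close>
  proof (induction rule: reachable_comparison_graph_induct)
    case refl
    have "B $$ (i, i) \<le> 1" if "B \<in> \<B>" for B
      using pairwise_comparison_matrix_diag[OF pc[OF that] \<open>i < n\<close>] by simp
    then show ?case by blast
  next
    case (step j k a)
    then obtain c where c: "\<And>B. B \<in> \<B> \<Longrightarrow> B $$ (i, j) \<le> c" by blast
    have "B $$ (i, k) \<le> M * (c * a)" if "B \<in> \<B>" for B
    proof -
      have "B $$ (j, k) = a" using step that completionD(2) by (auto simp: \<B>_def)
      moreover have "a > 0" using calculation pairwise_comparison_matrixD(1)[OF pc[OF that]] step by metis
      moreover have "B $$ (i, k) \<le> M * (B $$ (i, j) * B $$ (j, k))"
        by (rule triad_bound_all_orders[OF pc[OF that]])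
          (use that \<open>i < n\<close> step \<open>M \<ge> 1\<close> in \<open>auto simp: \<B>_def\<close>)
      moreover have "M * (B $$ (i, j) * a) \<le> M * (c * a)"
        using c[OF that] \<open>a > 0\<close> \<open>M \<ge> 1\<close> by simp
      ultimately show ?thesis by simp
    qed
    then show ?case by blast
  qed
  then obtain c where c: "\<And>i j B. \<lbrakk>i < n; j < n; B \<in> \<B>\<rbrakk> \<Longrightarrow> B $$ (i, j) \<le> c i j" by metis
  \<comment> \<open>The sum dominates every \<open>c i j\<close>; the summand 1 ensures
    \<open>L \<ge> 1\<close>.\<close>
  define L where "L = 1 + (\<Sum>(i, j)\<in>{..<n} \<times> {..<n}. \<bar>c i j\<bar>)"
  have "L \<ge> 1" by (auto simp: L_def intro: sum_nonneg)
  have le: "B $$ (i, j) \<le> L" if "i < n" "j < n" "B \<in> \<B>" for B i j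
  proof -
    have "\<bar>c i j\<bar> \<le> (\<Sum>(i, j)\<in>{..<n} \<times> {..<n}. \<bar>c i j\<bar>)"
      using member_le_sum[of "(i, j)" "{..<n} \<times> {..<n}" "\<lambda>(i, j). \<bar>c i j\<bar>"] that by auto
    then show ?thesis using c[OF that] by (simp add: L_def)
  qed
  show ?thesis
  proof
    show "L \<ge> 1" by fact
    fix B i j
    assume "completion n A B" "\<And>t. t \<in> triads n \<Longrightarrow> triad_inconsistency B t \<le> M" and ij: "i < n" "j < n"
    then have B: "B \<in> \<B>" by (simp add: \<B>_def)
    note pos = pairwise_comparison_matrixD[OF pc[OF B] ij]
    have "1 / B $$ (i, j) \<le> L" using le[OF ij(2,1) B] by (simp only: pos(2))
    then have "1 / L \<le> B $$ (i, j)" using pos(1) \<open>L \<ge> 1\<close> by (simp add: field_simps)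
    then show "B $$ (i, j) \<in> {1 / L..L}" using le[OF ij B] by simp
  qed
qed

text \<open>Tychonoff's theorem for a power of a closed interval.\<close>

lemma compact_box_fun:
  "compact {f :: 'a \<Rightarrow> real. \<forall>p. f p \<in> {l..u}}"
proof -
  have "compactin (product_topology (\<lambda>_::'a. euclidean) UNIV) (PiE UNIV (\<lambda>_. {l..u}))"
    by (subst compactin_PiE) auto
  moreover have "PiE UNIV (\<lambda>_. {l..u}) = {f :: 'a \<Rightarrow> real. \<forall>p. f p \<in> {l..u}}" by auto
  ultimately show ?thesis by (simp add: euclidean_product_topology)
qed

lemma lex_optimal_completion_exists:
  assumes A: "incomplete_pairwise_comparison_matrix n A"
    and conn: "\<And>i j. \<lbrakk>i < n; j < n\<rbrakk> \<Longrightarrow> i \<rightarrow>\<^sup>*\<^bsub>with_proj (comparison_graph n A)\<^esub> j"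
  shows "\<exists>B. lex_optimal_completion n A B"
proof -
  obtain B\<^sub>0 where B0: "completion n A B\<^sub>0" using completion_exists[OF A] ..
  \<comment> \<open>Large enough for all triads of \<open>B\<^sub>0\<close>, so that
    \<open>B\<^sub>0\<close> itself is among the matrices with triads bounded by
    \<open>M\<close>.\<close>
  define M where "M = 1 + (\<Sum>t\<in>triads n. triad_inconsistency B\<^sub>0 t)"
  note pos0 = triad_inconsistency_pos[OF completionD(1)[OF B0]]
  have "M \<ge> 1" using pos0 by (auto simp: M_def less_imp_le intro: sum_nonneg)
  have M0: "triad_inconsistency B\<^sub>0 t \<le> M" if "t \<in> triads n" for t
    using member_le_sum[OF that, of "triad_inconsistency B\<^sub>0"] pos0 finite_triads
    by (fastforce simp: M_def less_imp_le)
  obtain L where "L \<ge> 1" and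
    L: "\<And>B i j. \<lbrakk>completion n A B; \<And>t. t \<in> triads n \<Longrightarrow> triad_inconsistency B t \<le> M; i < n; j < n\<rbrakk>
      \<Longrightarrow> B $$ (i, j) \<in> {1 / L..L}"
    using completion_entries_bounded[OF A \<open>M \<ge> 1\<close> conn] by metis
  \<comment> \<open>Functions on index pairs carry the product topology. Reciprocity is written as a
    product equation and positivity as the bound \<open>1 / L\<close>, so that all conditions are
    closed; coordinates outside the matrix are merely confined to the interval, which keeps
    \<open>K\<close> compact.\<close>
  define K where "K = {f. \<forall>p. f p \<in> {1 / L..L}} \<inter>
    {f. \<forall>i j. i < n \<longrightarrow> j < n \<longrightarrow> f (i, j) * f (j, i) = 1} \<inter>
    {f. \<forall>i j a. i < n \<longrightarrow> j < n \<longrightarrow> A $$ (i, j) = Some a \<longrightarrow> f (i, j) = a}"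
  have "compact K"
    unfolding K_def
    by (intro compact_Int_closed compact_box_fun closed_Collect_all closed_Collect_imp
        open_Collect_const closed_Collect_eq continuous_on_mult continuous_on_const
        continuous_on_product_coordinates)
  have fpos: "f p > 0" if "f \<in> K" for f p
  proof -
    have "1 / L \<le> f p" using that by (cases p) (simp add: K_def)
    then show ?thesis using \<open>L \<ge> 1\<close> by (smt (verit) divide_pos_pos)
  qed
  have comp: "completion n A (mat n n f)" if "f \<in> K" for f
  proof -
    have "f (j, i) = 1 / f (i, j)" if "i < n" "j < n" for i j
    proof -
      have "f (i, j) * f (j, i) = 1" using \<open>f \<in> K\<close> that by (simp add: K_def)
      then show ?thesis using fpos[OF \<open>f \<in> K\<close>, of "(i, j)"] by (simp add: field_simps)
    qed
    with fpos[OF that] have "\<forall>i<n. \<forall>j<n. mat n n f $$ (i, j) > 0 \<and> mat n n f $$ (j, i) = 1 / mat n n f $$ (i, j)"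
      by (metis index_mat(1) old.prod.case)
    then have "pairwise_comparison_matrix n (mat n n f)"
      unfolding pairwise_comparison_matrix_def by (intro conjI mat_carrier)
    then show ?thesis using that by (simp add: completion_def K_def)
  qed
  have in_K: "\<exists>f\<in>K. mat n n f = B"
    if B: "completion n A B" "\<And>t. t \<in> triads n \<Longrightarrow> triad_inconsistency B t \<le> M" for B
  proof -
    note pc = completionD(1)[OF B(1)]
    \<comment> \<open>The default 1 outside the matrix lies in the interval because
      \<open>L \<ge> 1\<close>.\<close>
    define f where "f p = (if fst p < n \<and> snd p < n then B $$ p else 1)" for p
    have "B $$ (i, j) * B $$ (j, i) = 1" if "i < n" "j < n" for i j
      unfolding pairwise_comparison_matrixD(2)[OF pc that]
      using pairwise_comparison_matrixD(1)[OF pc that] by simp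
    then have "f \<in> K"
      using L[OF B] \<open>L \<ge> 1\<close> completionD(2)[OF B(1)]
      by (auto simp: K_def f_def)
    moreover have "B \<in> carrier_mat n n"
      using pc unfolding pairwise_comparison_matrix_def by blast
    then have "mat n n f = B"
      by (intro eq_matI) (auto simp: f_def)
    ultimately show ?thesis by blast
  qed
  define \<theta> where "\<theta> = (\<lambda>B v. sorted_values (triad_inconsistency B) (triads n) ! v)"
  have "continuous_on K (\<lambda>f. \<theta> (mat n n f) v)" if "v < card (triads n)" for v
    unfolding \<theta>_def
  proof (rule continuous_on_sorted_values[OF finite_triads that])
    fix t assume "t \<in> triads n"
    then obtain i j k where t: "t = (i, j, k)" "i < n" "j < n" "k < n" by (auto simp: triads_def)
    have "f p \<noteq> 0" if "f \<in> K" for f p using fpos[OF that, of p] by simp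
    moreover have "continuous_on K (\<lambda>f. f p)" for p
      by (rule continuous_on_subset[OF continuous_on_product_coordinates subset_UNIV])
    ultimately have "continuous_on K
        (\<lambda>f. max (f (i, k) / (f (i, j) * f (j, k))) (f (i, j) * f (j, k) / f (i, k)))"
      by (intro continuous_on_max continuous_on_divide continuous_on_mult) auto
    then show "continuous_on K (\<lambda>f. triad_inconsistency (mat n n f) t)"
      using t by (simp add: triad_inconsistency_def)
  qed
  moreover have "K \<noteq> {}" using in_K[OF B0 M0] by blast
  ultimately obtain f where f: "f \<in> K"
    "\<And>g. g \<in> K \<Longrightarrow> \<not> lex_below (card (triads n)) (\<theta> (mat n n g)) (\<theta> (mat n n f))"
    using compact_lex_minimal[OF \<open>compact K\<close>, of "card (triads n)" "\<lambda>f. \<theta> (mat n n f)"] by blast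
  \<comment> \<open>Competitors need not come from \<open>K\<close> a priori. One that beats the
    minimiser has a largest triad no greater than that of the minimiser, hence than that of
    \<open>B\<^sub>0\<close>, hence than \<open>M\<close>; so it does come from \<open>K\<close>, a
    contradiction.\<close>
  have "\<not> lex_below (card (triads n)) (\<theta> C) (\<theta> (mat n n f))" if C: "completion n A C" for C
  proof
    assume below: "lex_below (card (triads n)) (\<theta> C) (\<theta> (mat n n f))"
    then have "card (triads n) > 0" by (auto simp: lex_below_def)
    then have ne: "triads n \<noteq> {}" by auto
    have "\<not> lex_below (card (triads n)) (\<theta> B\<^sub>0) (\<theta> (mat n n f))"
      using in_K[OF B0 M0] f(2) by blast
    then have "\<theta> (mat n n f) 0 \<le> \<theta> B\<^sub>0 0"
      using \<open>card (triads n) > 0\<close> unfolding lex_below_def by (metis not_less not_less_zero)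
    also have "\<dots> \<le> M"
      using sorted_values_first_in[OF finite_triads ne, of "triad_inconsistency B\<^sub>0"] M0
      by (auto simp: \<theta>_def)
    finally have "\<theta> C 0 \<le> M" using lex_below_imp_first_le[OF below] by simp
    then have "triad_inconsistency C t \<le> M" if "t \<in> triads n" for t
      using sorted_values_first_ge[OF finite_triads that, of "triad_inconsistency C"]
      by (simp add: \<theta>_def)
    then show False using in_K[OF C] f(2) below by blast
  qed
  then have "lex_optimal_completion n A (mat n n f)"
    using comp[OF f(1)] by (simp add: lex_optimal_completion_iff \<theta>_def)
  then show ?thesis ..
qed

theorem theorem1:
  fixes n :: nat and A :: "real option mat"
  assumes "n > 0"
    and "incomplete_pairwise_comparison_matrix n A"
  shows "(\<exists>!B. lex_optimal_completion n A B) \<longleftrightarrow>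
         Digraph_Component.connected (with_proj (comparison_graph n A))"
  unfolding connected_comparison_graph_iff[OF assms(2,1)]
proof
  assume "\<exists>!B. lex_optimal_completion n A B"
  then show "\<forall>i<n. \<forall>j<n. i \<rightarrow>\<^sup>*\<^bsub>with_proj (comparison_graph n A)\<^esub> j"
    using not_unique_if_disconnected[OF assms(2)] by metis
next
  assume "\<forall>i<n. \<forall>j<n. i \<rightarrow>\<^sup>*\<^bsub>with_proj (comparison_graph n A)\<^esub> j"
  then show "\<exists>!B. lex_optimal_completion n A B"
    using lex_optimal_completion_exists[OF assms(2)] lex_optimal_completion_unique[OF assms(2)]
    by blast
qed

end
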